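(* For every positive integer $n$, $$\sum_{b\in B_n^{(1,2)}} u^{\deg_\theta(b)} v^{\deg_\xi(b)} q^{\deg_x(b)}\, Q_{\mathrm{Asc}(b),n} \;=\; \sum_{\substack{k,\ell\ge0\\ k+\ell<n}} u^k v^\ell \sum_{\sigma\in \mathrm{SW}(1^n,k,\ell)} q^{\mathrm{sminv}(\sigma)}\, Q_{\mathrm{Split}(\sigma),n}.$$
   Context: **Fundamental quasisymmetric functions.** For $S\subseteq\{1,\ldots,n-1\}$, $Q_{S,n}=\sum z_{a_1}z_{a_2}\cdots z_{a_n}$, summed over $a_1\le a_2\le\cdots\le a_n$ (positive integers) with $a_i<a_{i+1}$ whenever $i\in S$. **The set $B_n^{(1,2)}$.** A modified Motzkin path of length $n$ is a lattice path $\pi=(p_1,\ldots,p_n)$ in $\mathbb{Z}^2$ starting at $(0,0)$ whose $i$-th step $p_i$ is one of: an (undecorated) up-step $(1,1)$; a horizontal step $(1,0)$ with decoration $\theta_i$; a horizontal step $(1,0)$ with decoration $\xi_i$; a down-step $(1,-1)$ with decoration $\theta_i\xi_i$; such that the first step is an up-step and afterwards the path never goes below the line $y=1$. The set of these paths is $\Pi(n)_{>0}$. For $\pi\in\Pi(n)_{>0}$ let $T(\pi)$ (resp. $S(\pi)$) be the set of indices $i$ such that $\theta_i$ (resp. $\xi_i$) occurs in the decoration of $p_i$; both are subsets of $\{2,\ldots,n\}$. For $T,S\subseteq\{2,\ldots,n\}$ define $\alpha(T,S)$ by $\alpha_1(T,S)=0$ and, for $2\le i\le n$, $\alpha_i(T,S)=\alpha_{i-1}(T,S)-1+\chi(i\notin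 T)+\chi(i\notin S)$, where $\chi(P)=1$ if $P$ is true and $0$ otherwise. $B_n^{(1,2)}$ is the set of monomials $x^\alpha\theta_T\xi_S$ (with $x_i$ commuting, $\theta_i,\xi_i$ anticommuting variables, $\theta_T,\xi_S$ the products in increasing order of indices) such that $(T,S)=(T(\pi),S(\pi))$ for some $\pi\in\Pi(n)_{>0}$ and $0\le\alpha_i\le\alpha_i(T,S)$ for all $i$. Signs are irrelevant: we write $b=\pm\prod_{i=1}^n x_i^{\alpha_i}\theta_i^{\beta_i}\xi_i^{\gamma_i}$ with $\alpha_i\in\mathbb{Z}_{\ge0}$, $\beta_i,\gamma_i\in\{0,1\}$, and $\deg_x(b)=\sum\alpha_i$, $\deg_\theta(b)=\sum\beta_i$, $\deg_\xi(b)=\sum\gamma_i$. **Ascents of $b$.** An index $i\in\{1,\ldots,n-1\}$ is an ascent of $b$ iff one of: $\beta_i<\beta_{i+1}$; or $\beta_i=\beta_{i+1}=1$ and $\alpha_i\ge\alpha_{i+1}+\gamma_{i+1}$; or $\beta_i=\beta_{i+1}=0$ and $\alpha_i<\alpha_{i+1}+\gamma_{i+1}$. $\mathrm{Asc}(b)$ is the set of ascents of $b$. **Segmented permutations.** A segmented permutation of length $n$ is a permutation $\sigma_1\cdots\sigma_n$ of $\{1,\ldots,n\}$ cut into consecutive nonempty blocks. An ascent (resp. descent) of $\sigma$ is an index $i$ such that $\sigma_i,\sigma_{i+1}$ lie in the same block and $\sigma_i<\sigma_{i+1}$ (resp. $\sigma_i>\sigma_{i+1}$). $\mathrm{SW}(1^n,k,\ell)$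 is the set of segmented permutations of length $n$ with exactly $k$ ascents and $\ell$ descents. A sminversion of $\sigma$ is a pair $(i,j)$ with $1\le i<j\le n$, $\sigma_i>\sigma_j$, and either $\sigma_j$ is the first letter of its block or $\sigma_{j-1}>\sigma_i$; $\mathrm{sminv}(\sigma)$ is the number of sminversions. **Split.** An index $i$ is thick for $\sigma$ if it is the first position of its block or $\sigma_{i-1}>\sigma_i$; it is thin if it is not the first position of its block and $\sigma_{i-1}<\sigma_i$. A value $m=\sigma_i<n$, with $j$ defined by $\sigma_j=m+1$, is splitting for $\sigma$ if: $i$ is thick and $j$ is thin; or $i,j$ are both thin and $i<j$; or $i,j$ are both thick and $j<i$. $\mathrm{Split}(\sigma)$ is the set of $m\in\{1,\ldots,n-1\}$ that are splitting for $\sigma$. *)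

theory Defs
  imports
    "HOL-Library.Multiset"
    "HOL-Library.Function_Algebras"
    "HOL-Computational_Algebra.Polynomial"
    "HOL-Combinatorics.Multiset_Permutations"
begin

text \<open>All words and paths are lists, but positions are counted from 1 as in the literature.\<close>

abbreviation letter :: "'a list \<Rightarrow> nat \<Rightarrow> 'a" where
  "letter w i \<equiv> w ! (i - 1)"

text \<open>
  The coefficient ring is the polynomial ring in three indeterminates over the integers,
  built up as \<open>\<int>[u][v][q]\<close>.
\<close>

type_synonym coeff_ring = "int poly poly poly"

definition ind_u :: coeff_ring where "ind_u = [:[:[:0, 1:]:]:]"

definition ind_v :: coeff_ring where "ind_v = [:[:0, 1:]:]"

definition ind_q :: coeff_ring where "ind_q = [:0, 1:]"

text \<open>
  A monomial \<open>z\<^sub>a\<^sub>1 \<dots> z\<^sub>a\<^sub>n\<close> is the multiset of its variable indices; a formal power series in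
  \<open>z\<^sub>1, z\<^sub>2, \<dots>\<close> is its coefficient function.  Addition and zero are pointwise, from
  \<open>Function_Algebras\<close>.  The product of power series is not needed (and the pointwise
  product on functions is not it); only multiplication by a constant is.
\<close>

type_synonym zseries = "nat multiset \<Rightarrow> coeff_ring"

definition scale :: "coeff_ring \<Rightarrow> zseries \<Rightarrow> zseries" where
  "scale c f = (\<lambda>m. c * f m)"

definition fundamental_words :: "nat set \<Rightarrow> nat \<Rightarrow> nat list set" where
  "fundamental_words S n =
     {a. length a = n \<and> (\<forall>x\<in>set a. 1 \<le> x)
       \<and> (\<forall>i\<in>{1..<n}. letter a i \<le> letter a (i + 1))
       \<and> (\<forall>i\<in>{1..<n}. i \<in> S \<longrightarrow> letter a i < letter a (i + 1))}"

definition fundamental_qsym :: "nat set \<Rightarrow> nat \<Rightarrow> zseries" where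
  "fundamental_qsym S n =
     (\<lambda>m. of_nat (card {a \<in> fundamental_words S n. mset a = m}))"

datatype motzkin_step = Up | Level_theta | Level_xi | Down

fun rise :: "motzkin_step \<Rightarrow> int" where
  "rise Up = 1"
| "rise Level_theta = 0"
| "rise Level_xi = 0"
| "rise Down = -1"

text \<open>The path is at the point \<open>(i, height p i)\<close> after its first \<open>i\<close> steps.\<close>

definition height :: "motzkin_step list \<Rightarrow> nat \<Rightarrow> int" where
  "height p i = (\<Sum>s\<leftarrow>take i p. rise s)"

definition motzkin_paths :: "nat \<Rightarrow> motzkin_step list set" where
  "motzkin_paths n =
     {p. length p = n \<and> letter p 1 = Up \<and> (\<forall>i\<in>{1..n}. 1 \<le> height p i)}"

definition path_T :: "motzkin_step list \<Rightarrow> nat set" where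
  "path_T p = {i \<in> {1..length p}. letter p i \<in> {Level_theta, Down}}"

definition path_S :: "motzkin_step list \<Rightarrow> nat set" where
  "path_S p = {i \<in> {1..length p}. letter p i \<in> {Level_xi, Down}}"

text \<open>The value at index 0 is a dummy; the sequence starts at index 1.\<close>

primrec alpha_bound :: "nat set \<Rightarrow> nat set \<Rightarrow> nat \<Rightarrow> int" where
  "alpha_bound T S 0 = 0"
| "alpha_bound T S (Suc i) =
     (if i = 0 then 0
      else alpha_bound T S i - 1 + of_bool (Suc i \<notin> T) + of_bool (Suc i \<notin> S))"

text \<open>
  A monomial \<open>x\<^sup>\<alpha> \<theta>\<^sub>T \<xi>\<^sub>S\<close> up to sign: its exponent function \<open>\<alpha>\<close> and its index sets \<open>T\<close> and \<open>S\<close>.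
\<close>

datatype smonomial =
  SMonomial (x_exp: "nat \<Rightarrow> nat") (theta_set: "nat set") (xi_set: "nat set")

definition theta_exp :: "smonomial \<Rightarrow> nat \<Rightarrow> nat" where
  "theta_exp b i = of_bool (i \<in> theta_set b)"

definition xi_exp :: "smonomial \<Rightarrow> nat \<Rightarrow> nat" where
  "xi_exp b i = of_bool (i \<in> xi_set b)"

text \<open>
  Exponents vanish outside \<open>{1..n}\<close>, so that distinct elements are distinct monomials.
\<close>

definition B12 :: "nat \<Rightarrow> smonomial set" where
  "B12 n =
     {SMonomial \<alpha> T S | \<alpha> T S.
        (\<exists>p\<in>motzkin_paths n. T = path_T p \<and> S = path_S p)
        \<and> (\<forall>i\<in>{1..n}. int (\<alpha> i) \<le> alpha_bound T S i)
        \<and> (\<forall>i. i \<notin> {1..n} \<longrightarrow> \<alpha> i = 0)}"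

definition deg_x :: "nat \<Rightarrow> smonomial \<Rightarrow> nat" where
  "deg_x n b = (\<Sum>i=1..n. x_exp b i)"

definition deg_theta :: "nat \<Rightarrow> smonomial \<Rightarrow> nat" where
  "deg_theta n b = (\<Sum>i=1..n. theta_exp b i)"

definition deg_xi :: "nat \<Rightarrow> smonomial \<Rightarrow> nat" where
  "deg_xi n b = (\<Sum>i=1..n. xi_exp b i)"

definition Asc :: "nat \<Rightarrow> smonomial \<Rightarrow> nat set" where
  "Asc n b =
     {i \<in> {1..<n}.
        theta_exp b i < theta_exp b (i + 1)
        \<or> theta_exp b i = 1 \<and> theta_exp b (i + 1) = 1
            \<and> x_exp b i \<ge> x_exp b (i + 1) + xi_exp b (i + 1)
        \<or> theta_exp b i = 0 \<and> theta_exp b (i + 1) = 0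
            \<and> x_exp b i < x_exp b (i + 1) + xi_exp b (i + 1)}"

text \<open>A segmented permutation is the list of its blocks; \<open>concat \<sigma>\<close> is the underlying word.\<close>

type_synonym segperm = "nat list list"

definition segmented_permutations :: "nat \<Rightarrow> segperm set" where
  "segmented_permutations n =
     {\<sigma>. [] \<notin> set \<sigma> \<and> concat \<sigma> \<in> permutations_of_set {1..n}}"

definition block_starts :: "segperm \<Rightarrow> nat set" where
  "block_starts \<sigma> = {length (concat (take r \<sigma>)) + 1 | r. r < length \<sigma>}"

text \<open>
  Positions \<open>i\<close> and \<open>i + 1\<close> lie in the same block iff \<open>i + 1\<close> is not the first position of
  a block.
\<close>

definition sp_ascents :: "segperm \<Rightarrow> nat set" where
  "sp_ascents \<sigma> =
     {i \<in> {1..<length (concat \<sigma>)}.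
        i + 1 \<notin> block_starts \<sigma> \<and> letter (concat \<sigma>) i < letter (concat \<sigma>) (i + 1)}"

definition sp_descents :: "segperm \<Rightarrow> nat set" where
  "sp_descents \<sigma> =
     {i \<in> {1..<length (concat \<sigma>)}.
        i + 1 \<notin> block_starts \<sigma> \<and> letter (concat \<sigma>) i > letter (concat \<sigma>) (i + 1)}"

definition SW :: "nat \<Rightarrow> nat \<Rightarrow> nat \<Rightarrow> segperm set" where
  "SW n k l =
     {\<sigma> \<in> segmented_permutations n. card (sp_ascents \<sigma>) = k \<and> card (sp_descents \<sigma>) = l}"

definition sminversions :: "segperm \<Rightarrow> (nat \<times> nat) set" where
  "sminversions \<sigma> =
     {(i, j). 1 \<le> i \<and> i < j \<and> j \<le> length (concat \<sigma>)
        \<and> letter (concat \<sigma>) i > letter (concat \<sigma>) j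
        \<and> (j \<in> block_starts \<sigma> \<or> letter (concat \<sigma>) (j - 1) > letter (concat \<sigma>) i)}"

definition sminv :: "segperm \<Rightarrow> nat" where
  "sminv \<sigma> = card (sminversions \<sigma>)"

definition thick :: "segperm \<Rightarrow> nat \<Rightarrow> bool" where
  "thick \<sigma> i \<longleftrightarrow>
     i \<in> block_starts \<sigma> \<or> letter (concat \<sigma>) (i - 1) > letter (concat \<sigma>) i"

definition thin :: "segperm \<Rightarrow> nat \<Rightarrow> bool" where
  "thin \<sigma> i \<longleftrightarrow>
     i \<notin> block_starts \<sigma> \<and> letter (concat \<sigma>) (i - 1) < letter (concat \<sigma>) i"

definition Split :: "segperm \<Rightarrow> nat set" where
  "Split \<sigma> =
     {m \<in> {1..<length (concat \<sigma>)}.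
        \<exists>i\<in>{1..length (concat \<sigma>)}. \<exists>j\<in>{1..length (concat \<sigma>)}.
          letter (concat \<sigma>) i = m \<and> letter (concat \<sigma>) j = m + 1
          \<and> (thick \<sigma> i \<and> thin \<sigma> j
             \<or> thin \<sigma> i \<and> thin \<sigma> j \<and> i < j
             \<or> thick \<sigma> i \<and> thick \<sigma> j \<and> j < i)}"

end

theory Submission
  imports Defs
begin

text \<open>
  The identity comes from a bijection that preserves every statistic.  Restricting a segmented
  permutation to its values \<open>\<le> x\<close> leaves an ordered list of components, and \<open>x\<close> is
  inserted in one of four ways: as a new component (up-step), at the right end of a component
  (\<open>\<theta>\<close>), at the left end of a component (\<open>\<xi>\<close>), or joining two neighbours
  (down-step).  The height of the path is the number of components, and the exponent \<open>\<alpha>\<^sub>x\<close>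
  is the number of components to the right of the one containing \<open>x\<close>, which is also the number
  of sminversions whose larger value is \<open>x\<close>.  Counting components to the right also shows that
  \<open>m\<close> stands before \<open>m + 1\<close> iff \<open>\<alpha>\<^sub>m \<ge> \<alpha>\<^sub>m\<^sub>+\<^sub>1 + \<gamma>\<^sub>m\<^sub>+\<^sub>1\<close>,
  which turns splitting values into ascents of the monomial.
\<close>

section \<open>Statistics of a segmented permutation in terms of its values\<close>

text \<open>Adjacency, like \<open>before\<close>, is recorded between values rather than positions:
  inserting a larger letter shifts positions but leaves these relations on the old values
  intact.\<close>

definition adj :: "'a list list \<Rightarrow> ('a \<times> 'a) set" where
  "adj \<sigma> = (\<Union>b\<in>set \<sigma>. set (zip b (tl b)))"

primrec before :: "'a list \<Rightarrow> ('a \<times> 'a) set" where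
  "before [] = {}"
| "before (x # xs) = {x} \<times> set xs \<union> before xs"

text \<open>These are the tops of ascents. Like \<open>descent_tops\<close>, they record the larger
  letter of an adjacent pair, because the pair arises when that letter is inserted.\<close>

definition thin_vals :: "segperm \<Rightarrow> nat set" where
  "thin_vals \<sigma> = {v. \<exists>u<v. (u, v) \<in> adj \<sigma>}"

definition descent_tops :: "segperm \<Rightarrow> nat set" where
  "descent_tops \<sigma> = {v. \<exists>u<v. (v, u) \<in> adj \<sigma>}"

text \<open>Such a \<open>v\<close> opens a component, to the right of \<open>w\<close>, of the
  restriction to values at most \<open>w\<close>: its left neighbour in the block, if any, exceeds
  \<open>w\<close>.\<close>

definition later_starts :: "segperm \<Rightarrow> nat \<Rightarrow> nat set" where
  "later_starts \<sigma> w = {v. v < w \<and> (w, v) \<in> before (concat \<sigma>) \<and> (\<forall>u\<le>w. (u, v) \<notin> adj \<sigma>)}"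

definition monomial_of :: "segperm \<Rightarrow> smonomial" where
  "monomial_of \<sigma> = SMonomial (\<lambda>w. card (later_starts \<sigma> w)) (thin_vals \<sigma>) (descent_tops \<sigma>)"

section \<open>Adjacent pairs and order of occurrence in lists\<close>

lemma adj_simps [simp]:
  "adj [] = {}"
  "adj (b # \<sigma>) = set (zip b (tl b)) \<union> adj \<sigma>"
  "adj (\<sigma> @ \<tau>) = adj \<sigma> \<union> adj \<tau>"
  by (auto simp: adj_def)

lemma before_append [simp]:
  "before (xs @ ys) = before xs \<union> before ys \<union> set xs \<times> set ys"
  by (induction xs) auto

lemma before_subset: "before xs \<subseteq> set xs \<times> set xs"
  by (induction xs) auto

lemma before_conv_nth:
  "before xs = {(xs ! i, xs ! j) | i j. i < j \<and> j < length xs}"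
proof (induction xs)
  case (Cons x xs)
  show ?case
  proof (intro set_eqI iffI)
    fix p assume "p \<in> before (x # xs)"
    then consider y where "y \<in> set xs" "p = (x, y)" | "p \<in> before xs"
      by auto
    then show "p \<in> {((x # xs) ! i, (x # xs) ! j) | i j. i < j \<and> j < length (x # xs)}"
    proof cases
      case 1
      then obtain j where "j < length xs" "y = xs ! j" by (auto simp: in_set_conv_nth)
      then show ?thesis using 1 by (intro CollectI exI[of _ 0] exI[of _ "Suc j"]) auto
    next
      case 2
      then obtain i j where "i < j" "j < length xs" "p = (xs ! i, xs ! j)"
        using Cons.IH by auto
      then show ?thesis by (intro CollectI exI[of _ "Suc i"] exI[of _ "Suc j"]) auto
    qed
  next
    fix p assume "p \<in> {((x # xs) ! i, (x # xs) ! j) | i j. i < j \<and> j < length (x # xs)}"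
    then obtain i j where "i < j" "j < length (x # xs)" "p = ((x # xs) ! i, (x # xs) ! j)"
      by auto
    moreover from this obtain j' where "j = Suc j'" by (cases j) auto
    moreover have "(xs ! i', xs ! j') \<in> before xs" if "i' < j'" "j' < length xs" for i'
      unfolding Cons.IH using that by blast
    ultimately show "p \<in> before (x # xs)" by (cases i) auto
  qed
qed auto

lemma set_zip_tl_conv_nth:
  "set (zip b (tl b)) = {(b ! i, b ! Suc i) | i. Suc i < length b}"
  by (cases b) (auto simp: set_zip nth_tl)

lemma set_zip_tl_append:
  "set (zip (l @ x # r) (tl (l @ x # r))) =
     set (zip l (tl l)) \<union> set (zip r (tl r))
     \<union> (if l = [] then {} else {(last l, x)}) \<union> (if r = [] then {} else {(x, hd r)})"
proof (induction l)
  case Nil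
  show ?case by (cases r) auto
next
  case (Cons a l)
  then show ?case by (cases l) auto
qed

lemma set_zip_tl_subset: "set (zip b (tl b)) \<subseteq> set b \<times> set b"
  by (cases b) (auto dest: set_zip_leftD set_zip_rightD)

lemma adj_subset: "adj \<sigma> \<subseteq> set (concat \<sigma>) \<times> set (concat \<sigma>)"
  using set_zip_tl_subset unfolding adj_def by fastforce

lemma set_zip_tl_snd: "(\<exists>u. (u, v) \<in> set (zip b (tl b))) \<longleftrightarrow> v \<in> set (tl b)"
proof
  assume "v \<in> set (tl b)"
  then obtain i where "i < length (tl b)" "v = tl b ! i" by (auto simp: in_set_conv_nth)
  then have "Suc i < length b" "v = b ! Suc i" by (auto simp: nth_tl)
  then show "\<exists>u. (u, v) \<in> set (zip b (tl b))" unfolding set_zip_tl_conv_nth by auto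
qed (auto dest: set_zip_rightD)

section \<open>Inserting the largest value\<close>

text \<open>
  Removing the largest value \<open>x\<close> from the block \<open>l @ x # r\<close> leaves the blocks
  \<open>l\<close> and \<open>r\<close>, either of which may be empty; \<open>blk\<close> drops the empty ones, so
  that the four kinds of step are treated at once.
\<close>

definition blk :: "'a list \<Rightarrow> 'a list list" where
  "blk b = (if b = [] then [] else [b])"

lemma concat_blk [simp]: "concat (blk b) = b"
  and adj_blk [simp]: "adj (blk b) = set (zip b (tl b))"
  and length_blk [simp]: "length (blk b) = of_bool (b \<noteq> [])"
  and Nil_notin_blk [simp]: "[] \<notin> set (blk b)"
  by (auto simp: blk_def)

text \<open>One step of the path, with two flags in place of four step kinds: neither flag is an
  up-step, both are a down-step. The parameter \<open>a\<close> is the exponent at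
  \<open>x\<close>.\<close>

definition extend :: "nat \<Rightarrow> smonomial \<Rightarrow> bool \<Rightarrow> bool \<Rightarrow> nat \<Rightarrow> smonomial" where
  "extend x b \<beta> \<gamma> a = SMonomial ((x_exp b)(x := a))
     (if \<beta> then insert x (theta_set b) else theta_set b)
     (if \<gamma> then insert x (xi_set b) else xi_set b)"

text \<open>The surroundings of the largest letter \<open>x\<close>. An empty \<open>l\<close> or
  \<open>r\<close> encodes that \<open>x\<close> has no neighbour on that side of its block.\<close>

locale insertion =
  fixes A D :: segperm and l r :: "nat list" and x :: nat
  assumes distinct: "distinct (concat A @ l @ x # r @ concat D)"
    and less: "\<And>y. y \<in> set (concat A @ l @ r @ concat D) \<Longrightarrow> y < x"
    and nonempty: "[] \<notin> set A" "[] \<notin> set D"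
begin

definition old :: segperm where "old = A @ blk l @ blk r @ D"
definition new :: segperm where "new = A @ (l @ x # r) # D"

lemma concat_old: "concat old = concat A @ l @ r @ concat D"
  by (simp add: old_def)

lemma concat_new: "concat new = concat A @ l @ x # r @ concat D"
  by (simp add: new_def)

text \<open>\<open>l\<close> and \<open>r\<close> are separate blocks of \<open>old\<close>, so the
  insertion destroys no adjacent pair, and every pair it adds contains \<open>x\<close>.\<close>

lemma adj_new:
  "adj new = adj old \<union> (if l = [] then {} else {(last l, x)}) \<union> (if r = [] then {} else {(x, hd r)})"
  unfolding new_def old_def by (auto simp: set_zip_tl_append)

lemma adj_old_less: "(u, v) \<in> adj old \<Longrightarrow> u < x \<and> v < x"
  using adj_subset[of old] less unfolding concat_old by blast

lemma thin_vals_new: "thin_vals new = thin_vals old \<union> (if l = [] then {} else {x})"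
proof -
  have "l \<noteq> [] \<Longrightarrow> last l < x" using less by auto
  moreover have "r \<noteq> [] \<Longrightarrow> hd r < x" using less by auto
  ultimately show ?thesis unfolding thin_vals_def adj_new by (auto dest: adj_old_less)
qed

lemma descent_tops_new: "descent_tops new = descent_tops old \<union> (if r = [] then {} else {x})"
proof -
  have "l \<noteq> [] \<Longrightarrow> last l < x" using less by auto
  moreover have "r \<noteq> [] \<Longrightarrow> hd r < x" using less by auto
  ultimately show ?thesis unfolding descent_tops_def adj_new by (auto dest: adj_old_less)
qed

lemma x_notin_descent_tops_old: "x \<notin> descent_tops old"
  unfolding descent_tops_def by (auto dest: adj_old_less)

lemma before_new: "w \<noteq> x \<Longrightarrow> v \<noteq> x \<Longrightarrow> (w, v) \<in> before (concat new) \<longleftrightarrow> (w, v) \<in> before (concat old)"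
  unfolding concat_new concat_old by auto

text \<open>The pair \<open>(last l, x)\<close> has no effect because \<open>x\<close> is not below
  \<open>w\<close>, and \<open>(x, hd r)\<close> has none because only left neighbours
  \<open>u \<le> w\<close> are tested.\<close>

lemma later_starts_new: "w < x \<Longrightarrow> later_starts new w = later_starts old w"
  unfolding later_starts_def using before_new by (auto simp: adj_new)

text \<open>No letter exceeds \<open>x\<close>, so the condition on left neighbours says that
  \<open>v\<close> opens its block. After \<open>x\<close> come the rest \<open>r\<close> of its own
  block, where nothing opens a block, and the blocks of \<open>D\<close>.\<close>

lemma later_starts_x: "later_starts new x = hd ` set D"
proof -
  have before_x: "(x, v) \<in> before (concat new) \<longleftrightarrow> v \<in> set r \<union> set (concat D)" for v
    using distinct before_subset[of "concat A"] before_subset[of l]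
      before_subset[of r] before_subset[of "concat D"]
    unfolding concat_new by auto
  have le: "(u, v) \<in> adj new \<Longrightarrow> u \<le> x" for u v
    using less adj_old_less by (auto simp: adj_new less_imp_le split: if_splits)
  \<comment> \<open>The head of \<open>r\<close> has \<open>x\<close> as its left neighbour; every
    other letter of \<open>r\<close> has one inside \<open>r\<close>.\<close>
  have r: "\<exists>u. (u, v) \<in> adj new" if "v \<in> set r" for v
  proof -
    have "v = hd r \<or> v \<in> set (tl r)" using that by (cases r) auto
    then show ?thesis
      using that set_zip_tl_snd[of v r] by (fastforce simp: adj_new old_def)
  qed
  have D: "(\<exists>u. (u, v) \<in> adj new) \<longleftrightarrow> v \<noteq> hd b" if b: "b \<in> set D" "v \<in> set b" for v b
  proof
    have db: "distinct b" using distinct b by (auto simp: distinct_concat_iff)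
    have split: "v = hd b \<or> v \<in> set (tl b)" "hd b \<notin> set (tl b)"
      using db b by (cases b; auto)+
    assume "v \<noteq> hd b"
    then show "\<exists>u. (u, v) \<in> adj new"
      using split set_zip_tl_snd[of v b] b by (fastforce simp: adj_def new_def)
  next
    assume "\<exists>u. (u, v) \<in> adj new"
    then obtain u c where c: "c \<in> set new" "(u, v) \<in> set (zip c (tl c))"
      by (auto simp: adj_def)
    then have vc: "v \<in> set c" using set_zip_tl_subset by fastforce
    have "distinct (concat new)" using distinct concat_new by simp
    moreover have "b \<in> set new" using b by (simp add: new_def)
    \<comment> \<open>Blocks of a distinct word are pairwise disjoint, so the common letter
      \<open>v\<close> identifies \<open>c\<close> with \<open>b\<close>.\<close>
    ultimately have "c = b" and "distinct b"
      using vc b c by (auto simp: distinct_concat_iff)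
    then have "v \<in> set (tl b)" using c set_zip_tl_snd by fast
    then show "v \<noteq> hd b" using \<open>distinct b\<close> by (cases b) auto
  qed
  have "later_starts new x = {v \<in> set r \<union> set (concat D). \<not> (\<exists>u. (u, v) \<in> adj new)}"
  proof -
    have "(\<forall>u\<le>x. (u, v) \<notin> adj new) \<longleftrightarrow> \<not> (\<exists>u. (u, v) \<in> adj new)" for v
      using le by blast
    moreover have "v \<in> set r \<union> set (concat D) \<Longrightarrow> v < x" for v using less by auto
    ultimately show ?thesis unfolding later_starts_def using before_x by blast
  qed
  also have "\<dots> = {v \<in> set (concat D). \<not> (\<exists>u. (u, v) \<in> adj new)}"
    using r by auto
  also have "\<dots> = hd ` set D"
  proof (intro set_eqI iffI)
    fix v assume "v \<in> {v \<in> set (concat D). \<not> (\<exists>u. (u, v) \<in> adj new)}"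
    then obtain b where "b \<in> set D" "v \<in> set b" "\<not> (\<exists>u. (u, v) \<in> adj new)" by auto
    then show "v \<in> hd ` set D" using D by blast
  next
    fix v assume "v \<in> hd ` set D"
    then obtain b where b: "b \<in> set D" "v = hd b" by auto
    then have "v \<in> set b" using nonempty(2) by (metis list.set_sel(1))
    then show "v \<in> {v \<in> set (concat D). \<not> (\<exists>u. (u, v) \<in> adj new)}"
      using D b by fastforce
  qed
  finally show ?thesis .
qed

text \<open>Nonempty, pairwise disjoint blocks have different heads and cannot repeat, so counting
  heads counts blocks.\<close>

lemma card_later_starts_x: "card (later_starts new x) = length D"
proof -
  have dD: "distinct (concat D)" using distinct by simp
  have "inj_on hd (set D)"
  proof (rule inj_onI)
    fix b c assume "b \<in> set D" "c \<in> set D" "hd b = hd c"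
    moreover from this have "b \<noteq> []" "c \<noteq> []" using nonempty by auto
    ultimately have "hd b \<in> set b \<inter> set c" by (metis IntI list.set_sel(1))
    then show "b = c" using dD \<open>b \<in> set D\<close> \<open>c \<in> set D\<close> unfolding distinct_concat_iff by blast
  qed
  moreover have "distinct D"
    using dD nonempty(2) unfolding distinct_concat_iff by simp
  ultimately show ?thesis
    by (simp add: later_starts_x card_image distinct_card)
qed

lemma monomial_of_new:
  "monomial_of new = extend x (monomial_of old) (l \<noteq> []) (r \<noteq> []) (length D)"
proof -
  \<comment> \<open>Such a \<open>w\<close> is a letter of neither word, so both sets are
    empty.\<close>
  have "later_starts new w = later_starts old w" if "w > x" for w
  proof -
    have "w \<notin> set (concat new)" using that less unfolding concat_new by force
    moreover from this have "w \<notin> set (concat old)" unfolding concat_new concat_old by auto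
    ultimately show ?thesis unfolding later_starts_def using before_subset by fastforce
  qed
  then have "later_starts new w = later_starts old w" if "w \<noteq> x" for w
    using later_starts_new that by (metis nat_neq_iff)
  then have "(\<lambda>w. card (later_starts new w)) = (\<lambda>w. card (later_starts old w))(x := length D)"
    by (simp add: fun_eq_iff card_later_starts_x)
  then show ?thesis
    by (simp add: monomial_of_def extend_def thin_vals_new descent_tops_new)
qed

end

lemma insertion_max:
  assumes "distinct (concat \<sigma>)" "[] \<notin> set \<sigma>" "x \<in> set (concat \<sigma>)"
    and "\<And>y. y \<in> set (concat \<sigma>) \<Longrightarrow> y \<le> x"
  obtains A D l r where "insertion A D l r x" "\<sigma> = insertion.new A D l r x"
proof -
  from assms(3) obtain b where "b \<in> set \<sigma>" "x \<in> set b" by auto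
  then obtain A D l r where "\<sigma> = A @ b # D" and "b = l @ x # r"
    by (meson split_list)
  then have \<sigma>: "\<sigma> = A @ (l @ x # r) # D" by simp
  have "insertion A D l r x"
    using assms unfolding \<sigma> by unfold_locales (auto simp: order.strict_iff_order)
  then show thesis using that \<sigma> by (simp add: insertion.new_def)
qed

text \<open>The cardinality is the number of blocks to the right of the one holding the maximum
  \<open>x\<close>. That block lies in \<open>X\<close> iff all of \<open>Y\<close> is to its
  right.\<close>

lemma card_later_starts_max:
  assumes "distinct (concat (X @ Y))" "[] \<notin> set (X @ Y)" "x \<in> set (concat (X @ Y))"
    and max: "\<And>y. y \<in> set (concat (X @ Y)) \<Longrightarrow> y \<le> x"
  shows "x \<in> set (concat X) \<longleftrightarrow> length Y \<le> card (later_starts (X @ Y) x)"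
proof -
  obtain A D l r where ins: "insertion A D l r x" and eq: "X @ Y = insertion.new A D l r x"
    using insertion_max[OF assms] .
  have card: "card (later_starts (X @ Y) x) = length D"
    using insertion.card_later_starts_x[OF ins] eq by simp
  have dist: "set (concat X) \<inter> set (concat Y) = {}" using assms(1) by auto
  have eq': "X @ Y = A @ (l @ x # r) # D" using eq by (simp add: insertion.new_def[OF ins])
  \<comment> \<open>The block of \<open>x\<close> lies on one side of the cut; in the second case
    \<open>D\<close> is strictly shorter than \<open>Y\<close>.\<close>
  then consider us where "X = A @ (l @ x # r) # us" "D = us @ Y"
    | us where "Y = us @ (l @ x # r) # D"
    by (auto simp: append_eq_append_conv2 append_eq_Cons_conv)
  then show ?thesis
  proof cases
    case 1
    then show ?thesis using card by simp
  next
    case 2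
    then have "x \<in> set (concat Y)" by simp
    then show ?thesis using dist card 2 by auto
  qed
qed

text \<open>Cut \<open>old\<close> where \<open>x\<close> goes in: \<open>m\<close> precedes
  \<open>x\<close> iff it lies in \<open>A @ blk l\<close>. The right part \<open>blk r @ D\<close>
  has \<open>length D\<close> blocks, plus one if \<open>r\<close> is nonempty; this is the exponent
  of \<open>x\<close> plus its \<xi>-exponent. Then \<open>card_later_starts_max\<close> applies to
  the maximum \<open>m\<close> of \<open>old\<close>.\<close>

lemma (in insertion) before_x_iff:
  assumes m: "m \<in> set (concat old)" "\<And>y. y \<in> set (concat old) \<Longrightarrow> y \<le> m"
  shows "(m, x) \<in> before (concat new) \<longleftrightarrow>
           card (later_starts new x) + of_bool (x \<in> descent_tops new) \<le> card (later_starts new m)"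
proof -
  let ?X = "A @ blk l" and ?Y = "blk r @ D"
  have old: "old = ?X @ ?Y" by (simp add: old_def)
  have "distinct (concat old)" using distinct unfolding concat_old by auto
  moreover have "[] \<notin> set old" using nonempty by (simp add: old_def)
  ultimately have "m \<in> set (concat ?X) \<longleftrightarrow> length ?Y \<le> card (later_starts old m)"
    using card_later_starts_max[of ?X ?Y m] m unfolding old by blast
  moreover have "(m, x) \<in> before (concat new) \<longleftrightarrow> m \<in> set (concat ?X)"
    using distinct before_subset[of "concat A"] before_subset[of l]
      before_subset[of r] before_subset[of "concat D"]
    unfolding concat_new by auto
  moreover have "m < x" using less m unfolding concat_old by auto
  ultimately show ?thesis
    using x_notin_descent_tops_old
    by (auto simp: card_later_starts_x later_starts_new descent_tops_new)
qed

section \<open>The monomials of \<open>B12\<close>\<close>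

lemma alpha_bound_cong:
  assumes "\<And>j. j \<in> {1..i} \<Longrightarrow> j \<in> T \<longleftrightarrow> j \<in> T'" "\<And>j. j \<in> {1..i} \<Longrightarrow> j \<in> S \<longleftrightarrow> j \<in> S'"
  shows "alpha_bound T S i = alpha_bound T' S' i"
  using assms by (induction i) auto

text \<open>Both sequences have the same increments from index 2 on; the offset 1 comes from the
  initial up-step, where the bound starts at 0.\<close>

lemma height_eq_alpha_bound:
  assumes "letter p 1 = Up" "i \<in> {1..length p}"
  shows "height p i = alpha_bound (path_T p) (path_S p) i + 1"
  using assms(2)
proof (induction i)
  case (Suc i)
  have height: "height p (Suc i) = height p i + rise (p ! i)"
    using Suc.prems by (simp add: height_def take_Suc_conv_app_nth)
  show ?case
  proof (cases "i = 0")
    case True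
    then show ?thesis using height assms(1) by (simp add: height_def)
  next
    case False
    then show ?thesis using Suc height
      by (cases "p ! i") (auto simp: path_T_def path_S_def)
  qed
qed simp

text \<open>\<open>T\<close> and \<open>S\<close> determine the steps of the path. A natural number
  below the bound at each index makes the bound nonnegative, hence the height at least 1. That the
  first step is up becomes the exclusion of index 1 from both sets.\<close>

lemma B12_iff:
  assumes "n \<ge> 1"
  shows "b \<in> B12 n \<longleftrightarrow> theta_set b \<subseteq> {2..n} \<and> xi_set b \<subseteq> {2..n} \<and>
           (\<forall>i\<in>{1..n}. int (x_exp b i) \<le> alpha_bound (theta_set b) (xi_set b) i) \<and>
           (\<forall>i. i \<notin> {1..n} \<longrightarrow> x_exp b i = 0)"
    (is "_ \<longleftrightarrow> ?R")
proof
  assume "b \<in> B12 n"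
  then obtain \<alpha> p where b: "b = SMonomial \<alpha> (path_T p) (path_S p)" and p: "p \<in> motzkin_paths n"
    and \<alpha>: "\<forall>i\<in>{1..n}. int (\<alpha> i) \<le> alpha_bound (path_T p) (path_S p) i"
      "\<forall>i. i \<notin> {1..n} \<longrightarrow> \<alpha> i = 0"
    unfolding B12_def by blast
  from p have "length p = n" "letter p 1 = Up" by (auto simp: motzkin_paths_def)
  then have "path_T p \<subseteq> {1..n} - {1}" "path_S p \<subseteq> {1..n} - {1}"
    by (auto simp: path_T_def path_S_def)
  moreover have "{1..n} - {1} = {2..n}" by auto
  ultimately show ?R using \<alpha> by (simp add: b)
next
  assume R: ?R
  obtain \<alpha> T S where b: "b = SMonomial \<alpha> T S" by (cases b)
  define step where "step i =
    (if i \<in> T then if i \<in> S then Down else Level_theta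
     else if i \<in> S then Level_xi else Up)" for i
  define p where "p = map step [1..<Suc n]"
  have len: "length p = n" by (simp add: p_def)
  have letter: "letter p i = step i" if "i \<in> {1..n}" for i
    using that unfolding p_def by (subst nth_map) (auto simp del: upt_Suc)
  have TS: "T \<subseteq> {2..n}" "S \<subseteq> {2..n}"
    and \<alpha>: "\<forall>i\<in>{1..n}. int (\<alpha> i) \<le> alpha_bound T S i" "\<forall>i. i \<notin> {1..n} \<longrightarrow> \<alpha> i = 0"
    using R unfolding b smonomial.sel by blast+
  have path: "{i \<in> {1..n}. letter p i \<in> X} = {i \<in> {1..n}. step i \<in> X}" for X
    using letter by (intro Collect_cong) metis
  have T: "path_T p = T" and S: "path_S p = S"
    unfolding path_T_def path_S_def len path using TS by (auto simp: step_def)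
  have up: "letter p 1 = Up" using letter[of 1] assms TS by (auto simp: step_def)
  have "1 \<le> height p i" if "i \<in> {1..n}" for i
  proof -
    have "int (\<alpha> i) \<le> alpha_bound T S i" using \<alpha>(1) that by blast
    then show ?thesis using height_eq_alpha_bound[OF up, of i] that by (simp add: len T S)
  qed
  then have "p \<in> motzkin_paths n" using up len by (simp add: motzkin_paths_def)
  then show "b \<in> B12 n" using \<alpha> T S unfolding B12_def b by blast
qed

text \<open>The bound at an index depends only on membership of indices up to it, and
  \<open>n \<ge> 1\<close> keeps \<open>Suc n\<close> away from index 1, where the bound is set to
  0.\<close>

lemma alpha_bound_extend:
  fixes \<beta> \<gamma> :: bool and a :: nat
  assumes "theta_set b \<subseteq> {2..n}" "xi_set b \<subseteq> {2..n}" "n \<ge> 1"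
  defines "b' \<equiv> extend (Suc n) b \<beta> \<gamma> a"
  shows "alpha_bound (theta_set b') (xi_set b') (Suc n) =
           alpha_bound (theta_set b) (xi_set b) n + 1 - of_bool \<beta> - of_bool \<gamma>"
    and "i \<le> n \<Longrightarrow> alpha_bound (theta_set b') (xi_set b') i = alpha_bound (theta_set b) (xi_set b) i"
proof -
  show eq: "alpha_bound (theta_set b') (xi_set b') i = alpha_bound (theta_set b) (xi_set b) i"
    if "i \<le> n" for i
    using that by (intro alpha_bound_cong) (auto simp: b'_def extend_def)
  have "Suc n \<in> theta_set b' \<longleftrightarrow> \<beta>" "Suc n \<in> xi_set b' \<longleftrightarrow> \<gamma>"
    using assms(1,2) by (auto simp: b'_def extend_def)
  then show "alpha_bound (theta_set b') (xi_set b') (Suc n) =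
           alpha_bound (theta_set b) (xi_set b) n + 1 - of_bool \<beta> - of_bool \<gamma>"
    using eq[of n] assms(3) by simp
qed

text \<open>The inequality says that \<open>a\<close> is at most the bound at the new index, since
  each flag lowers that bound by one.\<close>

lemma extend_in_B12:
  assumes "b \<in> B12 n" "n \<ge> 1"
    and "int a + of_bool \<beta> + of_bool \<gamma> \<le> alpha_bound (theta_set b) (xi_set b) n + 1"
  shows "extend (Suc n) b \<beta> \<gamma> a \<in> B12 (Suc n)"
proof -
  let ?b = "extend (Suc n) b \<beta> \<gamma> a"
  have b: "theta_set b \<subseteq> {2..n}" "xi_set b \<subseteq> {2..n}"
    "\<forall>i\<in>{1..n}. int (x_exp b i) \<le> alpha_bound (theta_set b) (xi_set b) i"
    "\<forall>i. i \<notin> {1..n} \<longrightarrow> x_exp b i = 0"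
    using assms(1) B12_iff[OF assms(2)] by blast+
  have "int (x_exp ?b i) \<le> alpha_bound (theta_set ?b) (xi_set ?b) i" if "i \<in> {1..Suc n}" for i
  proof (cases "i = Suc n")
    case True
    then show ?thesis using alpha_bound_extend(1)[OF b(1,2) assms(2), of \<beta> \<gamma> a] assms(3)
      by (simp add: extend_def)
  next
    case False
    then show ?thesis using alpha_bound_extend(2)[OF b(1,2) assms(2), of i \<beta> \<gamma> a] b(3) that
      by (simp add: extend_def)
  qed
  moreover have "theta_set ?b \<subseteq> {2..Suc n}" "xi_set ?b \<subseteq> {2..Suc n}"
    using b(1,2) assms(2) by (auto simp: extend_def)
  moreover have "x_exp ?b i = 0" if "i \<notin> {1..Suc n}" for i
    using b(4) that by (auto simp: extend_def)
  ultimately show ?thesis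
    unfolding B12_iff[OF le_add1[of 1 n, unfolded plus_1_eq_Suc]] by blast
qed

text \<open>The inverse of \<open>extend\<close> erases \<open>Suc n\<close> from both sets and
  resets its exponent to 0, as membership in \<open>B12 n\<close> demands.\<close>

lemma B12_Suc_cases:
  assumes "b \<in> B12 (Suc n)" "n \<ge> 1"
  obtains b' \<beta> \<gamma> a where "b' \<in> B12 n" "b = extend (Suc n) b' \<beta> \<gamma> a"
    "int a + of_bool \<beta> + of_bool \<gamma> \<le> alpha_bound (theta_set b') (xi_set b') n + 1"
proof -
  have b: "theta_set b \<subseteq> {2..Suc n}" "xi_set b \<subseteq> {2..Suc n}"
    "\<forall>i\<in>{1..Suc n}. int (x_exp b i) \<le> alpha_bound (theta_set b) (xi_set b) i"
    "\<forall>i. i \<notin> {1..Suc n} \<longrightarrow> x_exp b i = 0"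
    using assms(1) unfolding B12_iff[OF le_add1[of 1 n, unfolded plus_1_eq_Suc]] by blast+
  define b' where
    "b' = SMonomial ((x_exp b)(Suc n := 0)) (theta_set b - {Suc n}) (xi_set b - {Suc n})"
  define \<beta> \<gamma> a where "\<beta> \<longleftrightarrow> Suc n \<in> theta_set b" and "\<gamma> \<longleftrightarrow> Suc n \<in> xi_set b"
    and "a = x_exp b (Suc n)"
  have ext: "b = extend (Suc n) b' \<beta> \<gamma> a"
    by (cases b) (auto simp: extend_def b'_def \<beta>_def \<gamma>_def a_def)
  have sub: "theta_set b' \<subseteq> {2..n}" "xi_set b' \<subseteq> {2..n}"
    using b(1,2) by (auto simp: b'_def le_Suc_eq)
  note bound = alpha_bound_extend[where \<beta> = \<beta> and \<gamma> = \<gamma> and a = a, OF sub assms(2), folded ext]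
  have "int (x_exp b' i) \<le> alpha_bound (theta_set b') (xi_set b') i" if "i \<in> {1..n}" for i
  proof -
    have "int (x_exp b i) \<le> alpha_bound (theta_set b) (xi_set b) i"
      using b(3) that by (auto simp del: alpha_bound.simps)
    moreover have "x_exp b' i = x_exp b i" using that by (simp add: b'_def)
    ultimately show ?thesis using bound(2)[of i] that by simp
  qed
  moreover have "x_exp b' i = 0" if "i \<notin> {1..n}" for i
    using b(4) that by (auto simp: b'_def)
  ultimately have b': "b' \<in> B12 n" using sub B12_iff[OF assms(2)] by blast
  have "int a \<le> alpha_bound (theta_set b) (xi_set b) (Suc n)"
    using bspec[OF b(3), of "Suc n"] by (simp only: a_def) simp
  then have "int a + of_bool \<beta> + of_bool \<gamma> \<le> alpha_bound (theta_set b') (xi_set b') n + 1"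
    using bound(1) by linarith
  then show thesis using that b' ext by blast
qed

text \<open>Members of \<open>B12 n\<close> carry nothing at index \<open>Suc n\<close>, so an
  extension shows there exactly its flags and \<open>a\<close>, and erasing that index returns the
  smaller monomial.\<close>

lemma extend_inject:
  assumes "b \<in> B12 n" "b' \<in> B12 n" "n \<ge> 1"
    and eq: "extend (Suc n) b \<beta> \<gamma> a = extend (Suc n) b' \<beta>' \<gamma>' a'"
  shows "b = b' \<and> \<beta> = \<beta>' \<and> \<gamma> = \<gamma>' \<and> a = a'"
proof -
  have notin: "Suc n \<notin> theta_set b" "Suc n \<notin> xi_set b" "x_exp b (Suc n) = 0"
    "Suc n \<notin> theta_set b'" "Suc n \<notin> xi_set b'" "x_exp b' (Suc n) = 0"
    using assms(1,2) B12_iff[OF assms(3)] by auto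
  have "(x_exp b)(Suc n := a) = (x_exp b')(Suc n := a')" using eq by (simp add: extend_def)
  then have x: "a = a'" "x_exp b = x_exp b'"
    using notin by (metis fun_upd_same, metis fun_upd_triv fun_upd_upd)
  moreover have "theta_set c = theta_set (extend (Suc n) c \<delta> \<epsilon> k) - {Suc n}"
      "xi_set c = xi_set (extend (Suc n) c \<delta> \<epsilon> k) - {Suc n}"
      "\<delta> \<longleftrightarrow> Suc n \<in> theta_set (extend (Suc n) c \<delta> \<epsilon> k)"
      "\<epsilon> \<longleftrightarrow> Suc n \<in> xi_set (extend (Suc n) c \<delta> \<epsilon> k)"
    if "c \<in> {b, b'}" for c \<delta> \<epsilon> k
    using notin that by (auto simp: extend_def)
  then have "theta_set b = theta_set b'" "xi_set b = xi_set b'" "\<beta> = \<beta>'" "\<gamma> = \<gamma>'"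
    using eq by (metis insertCI)+
  ultimately show ?thesis by (simp add: smonomial.expand)
qed

section \<open>The bijection\<close>

lemma segmented_permutations_iff:
  "\<sigma> \<in> segmented_permutations n \<longleftrightarrow>
     [] \<notin> set \<sigma> \<and> distinct (concat \<sigma>) \<and> set (concat \<sigma>) = {1..n}"
  unfolding segmented_permutations_def permutations_of_set_def by auto

lemma segmented_permutations_Suc_cases:
  assumes "\<sigma> \<in> segmented_permutations (Suc n)"
  obtains A D l r where "insertion A D l r (Suc n)" "\<sigma> = insertion.new A D l r (Suc n)"
    "insertion.old A D l r \<in> segmented_permutations n"
proof -
  have \<sigma>: "[] \<notin> set \<sigma>" "distinct (concat \<sigma>)" "set (concat \<sigma>) = {1..Suc n}"
    using assms segmented_permutations_iff by auto
  obtain A D l r where ins: "insertion A D l r (Suc n)" and new: "\<sigma> = insertion.new A D l r (Suc n)"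
    using insertion_max[of \<sigma> "Suc n"] \<sigma> by (metis Suc_le_mono atLeastAtMost_iff le0 le_refl One_nat_def)
  interpret insertion A D l r "Suc n" by (rule ins)
  have "set (concat old) = set (concat new) - {Suc n}"
    using distinct unfolding concat_old concat_new by auto
  also have "\<dots> = {1..n}" using \<sigma> new by auto
  finally have "old \<in> segmented_permutations n"
    using distinct nonempty unfolding segmented_permutations_iff concat_old
    by (auto simp: old_def)
  then show thesis using that ins new by blast
qed

text \<open>The parameters dictate the cut, read from the right: the last \<open>a\<close> blocks
  form \<open>D\<close>, the block before them is \<open>r\<close> if \<open>\<gamma>\<close> holds,
  the next one is \<open>l\<close> if \<open>\<beta>\<close> holds. The inequality guarantees enough
  blocks.\<close>

lemma ex_insertion:
  assumes "\<sigma> \<in> segmented_permutations n" "int a + of_bool \<beta> + of_bool \<gamma> \<le> int (length \<sigma>)"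
  obtains A D l r where "insertion A D l r (Suc n)" "\<sigma> = insertion.old A D l r"
    "insertion.new A D l r (Suc n) \<in> segmented_permutations (Suc n)"
    "l \<noteq> [] \<longleftrightarrow> \<beta>" "r \<noteq> [] \<longleftrightarrow> \<gamma>" "length D = a"
proof -
  have \<sigma>: "[] \<notin> set \<sigma>" "distinct (concat \<sigma>)" "set (concat \<sigma>) = {1..n}"
    using assms segmented_permutations_iff by auto
  define B where "B = take (length \<sigma> - a) \<sigma>"
  define D where "D = drop (length \<sigma> - a) \<sigma>"
  have BD: "\<sigma> = B @ D" by (simp add: B_def D_def)
  have "a \<le> length \<sigma>" using assms(2) by (cases \<beta>; cases \<gamma>) auto
  then have D: "length D = a" and B: "of_bool \<beta> + of_bool \<gamma> \<le> length B"
    using assms(2) by (auto simp: B_def D_def split: if_splits)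
  \<comment> \<open>The bound on \<open>length C\<close> reserves a block for
    \<open>l\<close>.\<close>
  have "\<exists>C r. B = C @ blk r \<and> (r \<noteq> [] \<longleftrightarrow> \<gamma>) \<and> of_bool \<beta> \<le> length C"
  proof (cases \<gamma>)
    case True
    then obtain C r where C: "B = C @ [r]" using B by (cases B rule: rev_cases) auto
    then have "r \<noteq> []" using \<sigma>(1) by (auto simp: BD)
    then show ?thesis using C B True by (intro exI[of _ C] exI[of _ r]) (auto simp: blk_def)
  next
    case False
    then show ?thesis using B by (intro exI[of _ B] exI[of _ "[]"]) (auto simp: blk_def)
  qed
  then obtain C r where C: "B = C @ blk r" "r \<noteq> [] \<longleftrightarrow> \<gamma>" "of_bool \<beta> \<le> length C" by blast
  have "\<exists>A l. C = A @ blk l \<and> (l \<noteq> [] \<longleftrightarrow> \<beta>)"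
  proof (cases \<beta>)
    case True
    then obtain A l where A: "C = A @ [l]" using C by (cases C rule: rev_cases) auto
    then have "l \<noteq> []" using \<sigma>(1) by (auto simp: BD C)
    then show ?thesis using A True by (intro exI[of _ A] exI[of _ l]) (auto simp: blk_def)
  next
    case False
    then show ?thesis by (intro exI[of _ C] exI[of _ "[]"]) (auto simp: blk_def)
  qed
  then obtain A l where A: "C = A @ blk l" "l \<noteq> [] \<longleftrightarrow> \<beta>" by blast
  have eq: "\<sigma> = A @ blk l @ blk r @ D" using BD C A by simp
  have set: "set (concat A @ l @ r @ concat D) = {1..n}" using \<sigma>(3) unfolding eq by simp
  interpret insertion A D l r "Suc n"
  proof
    have "Suc n \<notin> set (concat A @ l @ r @ concat D)" unfolding set by simp
    then show "distinct (concat A @ l @ Suc n # r @ concat D)"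
      using \<sigma>(2) unfolding eq by auto
    show "y < Suc n" if "y \<in> set (concat A @ l @ r @ concat D)" for y
      using that unfolding set by simp
  qed (use \<sigma>(1) eq in auto)
  have "set (concat new) = insert (Suc n) {1..n}" unfolding concat_new set[symmetric] by auto
  then have "new \<in> segmented_permutations (Suc n)"
    using distinct nonempty unfolding segmented_permutations_iff concat_new
    by (auto simp: new_def)
  then show thesis using that insertion_axioms eq A C D by (simp add: old_def)
qed

text \<open>The same increment as in \<open>alpha_bound_extend\<close>, which keeps the number of
  blocks one above the bound.\<close>

lemma (in insertion) length_new:
  "int (length new) = int (length old) + 1 - of_bool (l \<noteq> []) - of_bool (r \<noteq> [])"
  by (simp add: new_def old_def)

text \<open>Equal lengths of \<open>D\<close> and \<open>D'\<close> and equal emptiness of the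
  middle parts force \<open>A\<close> and \<open>A'\<close> to have equal length, after which the
  lists match block by block.\<close>

lemma insertion_unique:
  assumes "A @ blk l @ blk r @ D = A' @ blk l' @ blk r' @ D'"
    and "l = [] \<longleftrightarrow> l' = []" "r = [] \<longleftrightarrow> r' = []" "length D = length D'"
  shows "A = A' \<and> l = l' \<and> r = r' \<and> D = D'"
proof -
  have "length A = length A'" using arg_cong[OF assms(1), of length] assms(2-) by simp
  then show ?thesis using assms by (auto simp: blk_def split: if_splits)
qed

lemma segmented_permutations_1: "segmented_permutations 1 = {[[1]]}"
proof -
  have "\<sigma> = [[1]]" if \<sigma>: "\<sigma> \<in> segmented_permutations 1" for \<sigma>
  proof -
    have "distinct (concat \<sigma>)" "set (concat \<sigma>) = {1}" "[] \<notin> set \<sigma>"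
      using \<sigma> unfolding segmented_permutations_iff by auto
    then have "length (concat \<sigma>) = 1" using distinct_card[of "concat \<sigma>"] by simp
    then have "concat \<sigma> = [1]" using \<open>set (concat \<sigma>) = {1}\<close>
      by (cases "concat \<sigma>") auto
    then show ?thesis using \<open>[] \<notin> set \<sigma>\<close>
      by (cases \<sigma>; cases "hd \<sigma>"; cases "tl \<sigma>"; cases "hd (tl \<sigma>)") auto
  qed
  then show ?thesis by (auto simp: segmented_permutations_iff)
qed

lemma monomial_of_sel [simp]:
  "theta_set (monomial_of \<sigma>) = thin_vals \<sigma>"
  "xi_set (monomial_of \<sigma>) = descent_tops \<sigma>"
  "x_exp (monomial_of \<sigma>) = (\<lambda>w. card (later_starts \<sigma> w))"
  by (simp_all add: monomial_of_def)

lemma monomial_of_base: "monomial_of [[1]] = SMonomial (\<lambda>_. 0) {} {}"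
  by (simp add: monomial_of_def thin_vals_def descent_tops_def later_starts_def)

lemma B12_1: "B12 1 = {SMonomial (\<lambda>_. 0) {} {}}"
proof -
  have "b \<in> B12 1 \<longleftrightarrow> b = SMonomial (\<lambda>_. 0) {} {}" for b
    unfolding B12_iff[OF order_refl] by (cases b) (auto simp: fun_eq_iff, metis)
  then show ?thesis by blast
qed

text \<open>The number of blocks is carried along in the induction because it turns the condition on
  admissible extensions of a monomial into the condition on admissible insertions into a segmented
  permutation.\<close>

lemma monomial_of_bij:
  assumes "n \<ge> 1"
  shows "bij_betw monomial_of (segmented_permutations n) (B12 n) \<and>
    (\<forall>\<sigma>\<in>segmented_permutations n.
       int (length \<sigma>) = alpha_bound (thin_vals \<sigma>) (descent_tops \<sigma>) n + 1)"
  using assms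
proof (induction n rule: dec_induct)
  case base
  show ?case
    unfolding segmented_permutations_1 B12_1 monomial_of_base[symmetric]
    by (simp add: bij_betw_def)
next
  case (step n)
  note bij = conjunct1[OF step.IH]
  have len: "int (length \<sigma>) = alpha_bound (thin_vals \<sigma>) (descent_tops \<sigma>) n + 1"
    if "\<sigma> \<in> segmented_permutations n" for \<sigma> using step.IH that by blast
  have mem: "monomial_of \<sigma> \<in> B12 n" if "\<sigma> \<in> segmented_permutations n" for \<sigma>
    using bij that by (rule bij_betwE[rule_format])
  have sub: "thin_vals \<sigma> \<subseteq> {2..n}" "descent_tops \<sigma> \<subseteq> {2..n}"
    if "\<sigma> \<in> segmented_permutations n" for \<sigma>
    using mem[OF that] B12_iff[OF step.hyps(1), of "monomial_of \<sigma>"] by auto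
  have into: "monomial_of \<sigma> \<in> B12 (Suc n) \<and>
      int (length \<sigma>) = alpha_bound (thin_vals \<sigma>) (descent_tops \<sigma>) (Suc n) + 1"
    if \<sigma>: "\<sigma> \<in> segmented_permutations (Suc n)" for \<sigma>
  proof -
    obtain A D l r where ins: "insertion A D l r (Suc n)" and new: "\<sigma> = insertion.new A D l r (Suc n)"
      and old: "insertion.old A D l r \<in> segmented_permutations n"
      using \<sigma> by (rule segmented_permutations_Suc_cases)
    interpret insertion A D l r "Suc n" by (rule ins)
    have "int (length D) + of_bool (l \<noteq> []) + of_bool (r \<noteq> []) \<le> int (length old)"
      by (simp add: old_def)
    then have "monomial_of new \<in> B12 (Suc n)"
      unfolding monomial_of_new using len[OF old]
      by (intro extend_in_B12 mem old step.hyps) simp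
    moreover have "alpha_bound (thin_vals new) (descent_tops new) (Suc n) =
        alpha_bound (thin_vals old) (descent_tops old) n + 1 - of_bool (l \<noteq> []) - of_bool (r \<noteq> [])"
      using alpha_bound_extend(1)[of "monomial_of old" n "l \<noteq> []" "r \<noteq> []" "length D",
          folded monomial_of_new] sub[OF old] step.hyps
      by simp
    ultimately show ?thesis using len[OF old] length_new new by simp
  qed
  have "inj_on monomial_of (segmented_permutations (Suc n))"
  proof (rule inj_onI)
    fix \<sigma> \<tau>
    assume \<sigma>: "\<sigma> \<in> segmented_permutations (Suc n)" and \<tau>: "\<tau> \<in> segmented_permutations (Suc n)"
      and eq: "monomial_of \<sigma> = monomial_of \<tau>"
    obtain A D l r where ins: "insertion A D l r (Suc n)" and new: "\<sigma> = insertion.new A D l r (Suc n)"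
      and old: "insertion.old A D l r \<in> segmented_permutations n"
      using \<sigma> by (rule segmented_permutations_Suc_cases)
    obtain A' D' l' r' where ins': "insertion A' D' l' r' (Suc n)"
      and new': "\<tau> = insertion.new A' D' l' r' (Suc n)"
      and old': "insertion.old A' D' l' r' \<in> segmented_permutations n"
      using \<tau> by (rule segmented_permutations_Suc_cases)
    have *: "monomial_of (insertion.old A D l r) = monomial_of (insertion.old A' D' l' r') \<and>
        (l \<noteq> []) = (l' \<noteq> []) \<and> (r \<noteq> []) = (r' \<noteq> []) \<and> length D = length D'"
      using eq unfolding new new' insertion.monomial_of_new[OF ins] insertion.monomial_of_new[OF ins']
      by (rule extend_inject[OF mem[OF old] mem[OF old'] step.hyps(1)])
    \<comment> \<open>Injectivity one level down identifies the smaller permutations; the flags and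
      \<open>length D\<close> then identify the place of insertion.\<close>
    then have "insertion.old A D l r = insertion.old A' D' l' r'"
      using bij old old' unfolding bij_betw_def by (blast dest: inj_onD)
    then have "A = A' \<and> l = l' \<and> r = r' \<and> D = D'"
      unfolding insertion.old_def[OF ins] insertion.old_def[OF ins']
      by (rule insertion_unique) (use * in blast)+
    then show "\<sigma> = \<tau>" using new new' by simp
  qed
  moreover have "B12 (Suc n) \<subseteq> monomial_of ` segmented_permutations (Suc n)"
  proof
    fix b assume "b \<in> B12 (Suc n)"
    then obtain b' \<beta> \<gamma> a where b': "b' \<in> B12 n" and b: "b = extend (Suc n) b' \<beta> \<gamma> a"
      and le: "int a + of_bool \<beta> + of_bool \<gamma> \<le> alpha_bound (theta_set b') (xi_set b') n + 1"
      using step.hyps(1) by (rule B12_Suc_cases)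
    obtain \<sigma> where \<sigma>: "\<sigma> \<in> segmented_permutations n" "b' = monomial_of \<sigma>"
      using bij b' unfolding bij_betw_def by auto
    \<comment> \<open>The invariant on the number of blocks converts the bound for \<open>b'\<close>
      into room for the insertion.\<close>
    have "int a + of_bool \<beta> + of_bool \<gamma> \<le> int (length \<sigma>)" using le len \<sigma> by simp
    then obtain A D l r where ins: "insertion A D l r (Suc n)"
      and old: "\<sigma> = insertion.old A D l r"
      and new: "insertion.new A D l r (Suc n) \<in> segmented_permutations (Suc n)"
      and par: "l \<noteq> [] \<longleftrightarrow> \<beta>" "r \<noteq> [] \<longleftrightarrow> \<gamma>" "length D = a"
      using ex_insertion[OF \<sigma>(1)] by metis
    from new show "b \<in> monomial_of ` segmented_permutations (Suc n)"
    proof (rule rev_image_eqI)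
      show "b = monomial_of (insertion.new A D l r (Suc n))"
        unfolding insertion.monomial_of_new[OF ins] b \<sigma>(2) par by (simp only: old)
    qed
  qed
  ultimately show ?case using into unfolding bij_betw_def by blast
qed

text \<open>Removing values larger than \<open>Suc m\<close> changes neither side. Once
  \<open>Suc m\<close> is the largest value, \<open>m\<close> is the maximum of the rest and
  \<open>before_x_iff\<close> applies.\<close>

lemma before_Suc_iff:
  assumes "\<sigma> \<in> segmented_permutations n" "m \<in> {1..<n}"
  shows "(m, Suc m) \<in> before (concat \<sigma>) \<longleftrightarrow>
    card (later_starts \<sigma> (Suc m)) + of_bool (Suc m \<in> descent_tops \<sigma>) \<le> card (later_starts \<sigma> m)"
  using assms
proof (induction n arbitrary: \<sigma>)
  case (Suc n)
  obtain A D l r where ins: "insertion A D l r (Suc n)" and new: "\<sigma> = insertion.new A D l r (Suc n)"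
    and old: "insertion.old A D l r \<in> segmented_permutations n"
    using Suc.prems(1) by (rule segmented_permutations_Suc_cases)
  interpret insertion A D l r "Suc n" by (rule ins)
  have set_old: "set (concat old) = {1..n}" using old segmented_permutations_iff by auto
  show ?case
  proof (cases "m = n")
    case True
    have "n \<in> set (concat old)" "\<And>y. y \<in> set (concat old) \<Longrightarrow> y \<le> n"
      using Suc.prems(2) True unfolding set_old by auto
    then show ?thesis using before_x_iff new True by simp
  next
    case False
    then have m: "m \<in> {1..<n}" using Suc.prems(2) by auto
    have "(m, Suc m) \<in> before (concat new) \<longleftrightarrow> (m, Suc m) \<in> before (concat old)"
      using m by (intro before_new) auto
    moreover have "Suc m \<in> descent_tops new \<longleftrightarrow> Suc m \<in> descent_tops old"
      using m by (auto simp: descent_tops_new)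
    ultimately show ?thesis using Suc.IH[OF old m] m new by (simp add: later_starts_new)
  qed
qed simp

section \<open>From positions to values\<close>

lemma block_starts_Nil [simp]: "block_starts [] = {}"
  by (simp add: block_starts_def)

lemma block_starts_Cons [simp]:
  "block_starts (b # \<sigma>) = insert 1 ((+) (length b) ` block_starts \<sigma>)"
proof (intro set_eqI iffI)
  fix j assume "j \<in> block_starts (b # \<sigma>)"
  then obtain r where r: "j = length (concat (take r (b # \<sigma>))) + 1" "r < length (b # \<sigma>)"
    unfolding block_starts_def by blast
  then show "j \<in> insert 1 ((+) (length b) ` block_starts \<sigma>)"
    by (cases r) (auto simp: block_starts_def image_iff)
next
  fix j assume "j \<in> insert 1 ((+) (length b) ` block_starts \<sigma>)"
  then consider "j = 1" | r where "r < length \<sigma>" "j = length b + (length (concat (take r \<sigma>)) + 1)"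
    unfolding block_starts_def by auto
  then show "j \<in> block_starts (b # \<sigma>)"
  proof cases
    case 1
    then show ?thesis unfolding block_starts_def by (intro CollectI exI[of _ 0]) simp
  next
    case 2
    then show ?thesis unfolding block_starts_def by (intro CollectI exI[of _ "Suc r"]) simp
  qed
qed

lemma block_starts_ge_1: "j \<in> block_starts \<sigma> \<Longrightarrow> 1 \<le> j"
  by (auto simp: block_starts_def)

text \<open>Induction on the blocks: a position lies inside the first block, at its end, or beyond
  it.\<close>

lemma adj_conv_letter:
  assumes "[] \<notin> set \<sigma>"
  shows "adj \<sigma> = {(letter (concat \<sigma>) i, letter (concat \<sigma>) (i + 1)) | i.
           i \<in> {1..<length (concat \<sigma>)} \<and> i + 1 \<notin> block_starts \<sigma>}"
  using assms
proof (induction \<sigma>)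
  case (Cons b \<sigma>)
  let ?w = "concat \<sigma>"
  let ?R = "{(letter (b @ ?w) i, letter (b @ ?w) (i + 1)) | i.
    i \<in> {1..<length (b @ ?w)} \<and> i + 1 \<notin> block_starts (b # \<sigma>)}"
  have IH: "adj \<sigma> = {(letter ?w i, letter ?w (i + 1)) | i.
      i \<in> {1..<length ?w} \<and> i + 1 \<notin> block_starts \<sigma>}"
    using Cons by simp
  have one: "\<sigma> \<noteq> [] \<Longrightarrow> 1 \<in> block_starts \<sigma>" by (cases \<sigma>) auto
  have "p \<in> ?R" if p: "p \<in> adj (b # \<sigma>)" for p
  proof -
    consider "p \<in> set (zip b (tl b))" | "p \<in> adj \<sigma>" using p by auto
    then show ?thesis
    proof cases
      case 1
      then obtain i where i: "Suc i < length b" "p = (b ! i, b ! Suc i)"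
        unfolding set_zip_tl_conv_nth by auto
      \<comment> \<open>List index \<open>i\<close> is position \<open>i + 1\<close>. Position
        \<open>i + 2\<close> is still inside \<open>b\<close>, whereas later blocks start after
        position \<open>length b\<close>.\<close>
      then have "i + 1 + 1 \<notin> block_starts (b # \<sigma>)" using block_starts_ge_1 by fastforce
      then show ?thesis using i by (intro CollectI exI[of _ "i + 1"]) (auto simp: nth_append)
    next
      case 2
      then obtain i where i: "i \<in> {1..<length ?w}" "i + 1 \<notin> block_starts \<sigma>"
        "p = (letter ?w i, letter ?w (i + 1))" unfolding IH by auto
      then have "length b + i + 1 \<notin> block_starts (b # \<sigma>)"
        by (auto simp: image_iff)
      then show ?thesis using i
        by (intro CollectI exI[of _ "length b + i"]) (auto simp: nth_append)
    qed
  qed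
  moreover have "p \<in> adj (b # \<sigma>)" if p: "p \<in> ?R" for p
  proof -
    obtain i where i: "i \<in> {1..<length (b @ ?w)}" "i + 1 \<notin> block_starts (b # \<sigma>)"
      "p = (letter (b @ ?w) i, letter (b @ ?w) (i + 1))" using p by blast
    consider "i < length b" | "i = length b" | k where "i = length b + k" "1 \<le> k"
      by (metis less_imp_add_positive linorder_neqE_nat One_nat_def Suc_leI)
    then show ?thesis
    proof cases
      case 1
      then have "p = (b ! (i - 1), b ! Suc (i - 1))" "Suc (i - 1) < length b"
        using i by (auto simp: nth_append)
      then show ?thesis unfolding adj_simps set_zip_tl_conv_nth by blast
    next
      case 2
      \<comment> \<open>At the end of \<open>b\<close> the next position starts a block or lies
        beyond the word, so this case cannot occur.\<close>
      then show ?thesis using i one by (cases \<sigma>) auto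
    next
      case 3
      then have "p = (letter ?w k, letter ?w (k + 1))" "k \<in> {1..<length ?w}"
        using i by (auto simp: nth_append)
      moreover have "k + 1 \<notin> block_starts \<sigma>" using i(2) 3 by (auto simp: image_iff)
      ultimately have "p \<in> adj \<sigma>" unfolding IH by blast
      then show ?thesis by simp
    qed
  qed
  ultimately show ?case by (simp only: concat.simps) blast
qed simp

section \<open>Transfer of the statistics for a fixed segmented permutation\<close>

context
  fixes \<sigma> n
  assumes \<sigma>: "\<sigma> \<in> segmented_permutations n"
begin

private abbreviation "w \<equiv> letter (concat \<sigma>)"

lemma length_concat_segmented: "length (concat \<sigma>) = n"
  using \<sigma> distinct_card[of "concat \<sigma>"] unfolding segmented_permutations_iff by simp

lemma bij_betw_letter: "bij_betw w {1..n} {1..n}"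
proof -
  have d: "distinct (concat \<sigma>)" "set (concat \<sigma>) = {1..n}"
    using \<sigma> unfolding segmented_permutations_iff by auto
  have "bij_betw ((!) (concat \<sigma>)) {..<n} {1..n}"
    using bij_betw_nth[OF d(1) refl refl] d(2) length_concat_segmented by simp
  moreover have "bij_betw (\<lambda>i. i - 1) {1..n} {..<n}"
    by (rule bij_betw_byWitness[where f' = Suc]) auto
  ultimately show ?thesis using bij_betw_trans by (fastforce simp: comp_def)
qed

lemma letter_in: "i \<in> {1..n} \<Longrightarrow> w i \<in> {1..n}"
  using bij_betw_letter by (rule bij_betwE[rule_format])

lemma letter_inj: "i \<in> {1..n} \<Longrightarrow> j \<in> {1..n} \<Longrightarrow> w i = w j \<longleftrightarrow> i = j"
  by (rule inj_on_eq_iff[OF bij_betw_imp_inj_on[OF bij_betw_letter]])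

lemma letter_surj:
  assumes "v \<in> {1..n}"
  obtains i where "i \<in> {1..n}" "v = w i"
proof -
  have "v \<in> w ` {1..n}" using assms unfolding bij_betw_imp_surj_on[OF bij_betw_letter] .
  then show thesis using that by blast
qed

text \<open>Letters are distinct, so \<open>w j\<close> determines \<open>j\<close>, and its left
  neighbour in the block can only be the letter at \<open>j - 1\<close>.\<close>

lemma adj_letter_iff:
  assumes j: "j \<in> {1..n}"
  shows "(u, w j) \<in> adj \<sigma> \<longleftrightarrow> j \<notin> block_starts \<sigma> \<and> u = w (j - 1)"
proof -
  have ne: "[] \<notin> set \<sigma>" using \<sigma> unfolding segmented_permutations_iff by simp
  have one: "1 \<in> block_starts \<sigma>" using j length_concat_segmented by (cases \<sigma>) auto
  show ?thesis
  proof
    assume "(u, w j) \<in> adj \<sigma>"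
    then obtain i where i: "i \<in> {1..<n}" "i + 1 \<notin> block_starts \<sigma>" "u = w i" "w j = w (i + 1)"
      unfolding adj_conv_letter[OF ne] length_concat_segmented by blast
    then have "j = i + 1" using letter_inj[of j "i + 1"] j by auto
    then show "j \<notin> block_starts \<sigma> \<and> u = w (j - 1)" using i by simp
  next
    assume A: "j \<notin> block_starts \<sigma> \<and> u = w (j - 1)"
    \<comment> \<open>Position 1 starts a block, so \<open>j - 1\<close> is again a position, at
      least 1.\<close>
    then have "j \<noteq> 1" using one by metis
    then have "j - 1 \<in> {1..<n}" "j - 1 + 1 = j" using j by auto
    then show "(u, w j) \<in> adj \<sigma>"
      unfolding adj_conv_letter[OF ne] length_concat_segmented using A by (metis (mono_tags, lifting) mem_Collect_eq)
  qed
qed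

text \<open>This makes thick and thin complementary: away from block starts a letter has a left
  neighbour and differs from it.\<close>

lemma letter_neq_pred: "j \<in> {1..n} \<Longrightarrow> j \<notin> block_starts \<sigma> \<Longrightarrow> 2 \<le> j \<and> w (j - 1) \<noteq> w j"
proof -
  assume j: "j \<in> {1..n}" "j \<notin> block_starts \<sigma>"
  have "1 \<in> block_starts \<sigma>" using j length_concat_segmented by (cases \<sigma>) auto
  then have "2 \<le> j" using j by (cases "j = 1") auto
  then have "j - 1 \<in> {1..n}" "j - 1 \<noteq> j" using j by auto
  then show ?thesis using letter_inj j(1) \<open>2 \<le> j\<close> by blast
qed

lemma thin_iff:
  assumes "j \<in> {1..n}"
  shows "thin \<sigma> j \<longleftrightarrow> w j \<in> thin_vals \<sigma>"
  unfolding thin_def thin_vals_def mem_Collect_eq adj_letter_iff[OF assms] by blast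

lemma thick_iff:
  assumes "j \<in> {1..n}"
  shows "thick \<sigma> j \<longleftrightarrow> w j \<notin> thin_vals \<sigma>"
  unfolding thick_def thin_vals_def mem_Collect_eq adj_letter_iff[OF assms]
  using letter_neq_pred[OF assms] linorder_neq_iff[of "w (j - 1)" "w j"]
    order.asym[of "w (j - 1)" "w j"] by blast

lemma before_letter_iff:
  assumes "i \<in> {1..n}" "j \<in> {1..n}"
  shows "(w i, w j) \<in> before (concat \<sigma>) \<longleftrightarrow> i < j"
proof
  assume "(w i, w j) \<in> before (concat \<sigma>)"
  then obtain i' j' where "i' < j'" "j' < n" "w i = concat \<sigma> ! i'" "w j = concat \<sigma> ! j'"
    unfolding before_conv_nth length_concat_segmented by auto
  then show "i < j"
    using letter_inj[of i "i' + 1"] letter_inj[of j "j' + 1"] assms by auto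
next
  assume "i < j"
  then show "(w i, w j) \<in> before (concat \<sigma>)"
    unfolding before_conv_nth length_concat_segmented using assms
    by (intro CollectI exI[of _ "i - 1"] exI[of _ "j - 1"]) auto
qed

lemma adj_subset_segmented: "(u, v) \<in> adj \<sigma> \<Longrightarrow> u \<in> {1..n} \<and> v \<in> {1..n}"
  using adj_subset[of \<sigma>] \<sigma> unfolding segmented_permutations_iff by blast

text \<open>Each ascent \<open>i\<close> is matched with its top, the letter at
  \<open>i + 1\<close>; distinct letters ensure that no top arises twice.\<close>

lemma card_sp_ascents: "card (sp_ascents \<sigma>) = card (thin_vals \<sigma>)"
proof -
  have "bij_betw (\<lambda>i. w (i + 1)) (sp_ascents \<sigma>) (thin_vals \<sigma>)"
  proof (intro bij_betw_imageI inj_onI)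
    fix i j assume "i \<in> sp_ascents \<sigma>" "j \<in> sp_ascents \<sigma>" "w (i + 1) = w (j + 1)"
    then show "i = j" using letter_inj[of "i + 1" "j + 1"]
      unfolding sp_ascents_def length_concat_segmented by auto
  next
    show "(\<lambda>i. w (i + 1)) ` sp_ascents \<sigma> = thin_vals \<sigma>"
    proof (intro set_eqI iffI)
      fix v assume "v \<in> (\<lambda>i. w (i + 1)) ` sp_ascents \<sigma>"
      then obtain i where "i \<in> {1..<n}" "i + 1 \<notin> block_starts \<sigma>" "w i < w (i + 1)" "v = w (i + 1)"
        unfolding sp_ascents_def length_concat_segmented by blast
      then show "v \<in> thin_vals \<sigma>" unfolding thin_vals_def
        using adj_letter_iff[of "i + 1" "w i"] by auto
    next
      fix v assume "v \<in> thin_vals \<sigma>"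
      then obtain u where u: "u < v" "(u, v) \<in> adj \<sigma>" unfolding thin_vals_def by blast
      then obtain j where j: "j \<in> {1..n}" "v = w j" using adj_subset_segmented letter_surj by metis
      then have "j \<notin> block_starts \<sigma>" "u = w (j - 1)" using u adj_letter_iff by auto
      moreover from this have "2 \<le> j" using letter_neq_pred j by blast
      ultimately show "v \<in> (\<lambda>i. w (i + 1)) ` sp_ascents \<sigma>"
        using j u unfolding sp_ascents_def length_concat_segmented
        by (intro image_eqI[of _ _ "j - 1"]) auto
    qed
  qed
  then show ?thesis by (rule bij_betw_same_card)
qed

lemma card_sp_descents: "card (sp_descents \<sigma>) = card (descent_tops \<sigma>)"
proof -
  have "bij_betw w (sp_descents \<sigma>) (descent_tops \<sigma>)"
  proof (intro bij_betw_imageI inj_onI)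
    fix i j assume "i \<in> sp_descents \<sigma>" "j \<in> sp_descents \<sigma>" "w i = w j"
    then show "i = j" using letter_inj[of i j]
      unfolding sp_descents_def length_concat_segmented by auto
  next
    show "w ` sp_descents \<sigma> = descent_tops \<sigma>"
    proof (intro set_eqI iffI)
      fix v assume "v \<in> w ` sp_descents \<sigma>"
      then obtain i where "i \<in> {1..<n}" "i + 1 \<notin> block_starts \<sigma>" "w i > w (i + 1)" "v = w i"
        unfolding sp_descents_def length_concat_segmented by blast
      then show "v \<in> descent_tops \<sigma>" unfolding descent_tops_def
        using adj_letter_iff[of "i + 1" "w i"] by auto
    next
      fix v assume "v \<in> descent_tops \<sigma>"
      then obtain u where u: "u < v" "(v, u) \<in> adj \<sigma>" unfolding descent_tops_def by blast
      \<comment> \<open>The top of a descent is its left letter, so the position is found from the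
        bottom \<open>u\<close>, whose left neighbour \<open>adj_letter_iff\<close>
        describes.\<close>
      then obtain j where j: "j \<in> {1..n}" "u = w j" using adj_subset_segmented letter_surj by metis
      then have "j \<notin> block_starts \<sigma>" "v = w (j - 1)" using u adj_letter_iff by auto
      moreover from this have "2 \<le> j" using letter_neq_pred j by blast
      ultimately show "v \<in> w ` sp_descents \<sigma>"
        using j u unfolding sp_descents_def length_concat_segmented
        by (intro image_eqI[of _ _ "j - 1"]) auto
    qed
  qed
  then show ?thesis by (rule bij_betw_same_card)
qed

text \<open>That no \<open>u \<le> w i\<close> is the left neighbour of \<open>w j\<close> means
  that \<open>j\<close> starts a block or the letter at \<open>j - 1\<close> exceeds
  \<open>w i\<close>.\<close>

lemma later_starts_letter_iff:
  assumes "i \<in> {1..n}" "j \<in> {1..n}"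
  shows "w j \<in> later_starts \<sigma> (w i) \<longleftrightarrow> (i, j) \<in> sminversions \<sigma>"
  unfolding later_starts_def sminversions_def mem_Collect_eq prod.case
    before_letter_iff[OF assms] adj_letter_iff[OF assms(2)] length_concat_segmented
  using assms by (auto simp: not_le)

lemma later_starts_subset: "later_starts \<sigma> v \<subseteq> {1..n}"
  using before_subset[of "concat \<sigma>"] \<sigma> unfolding segmented_permutations_iff later_starts_def
  by blast

text \<open>Sminversions are grouped by their larger value, after both positions are replaced by the
  letters there.\<close>

lemma sminv_eq: "sminv \<sigma> = (\<Sum>v=1..n. card (later_starts \<sigma> v))"
proof -
  have range: "i \<in> {1..n} \<and> j \<in> {1..n}" if "(i, j) \<in> sminversions \<sigma>" for i j
    using that by (auto simp: sminversions_def length_concat_segmented)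
  have "bij_betw (map_prod w w) (sminversions \<sigma>) (SIGMA v:{1..n}. later_starts \<sigma> v)"
  proof (intro bij_betw_imageI inj_onI)
    fix p q assume "p \<in> sminversions \<sigma>" "q \<in> sminversions \<sigma>" "map_prod w w p = map_prod w w q"
    then show "p = q" using range letter_inj by (cases p; cases q) (metis map_prod_simp prod.inject)
  next
    show "map_prod w w ` sminversions \<sigma> = (SIGMA v:{1..n}. later_starts \<sigma> v)"
    proof (intro set_eqI iffI)
      fix p assume "p \<in> map_prod w w ` sminversions \<sigma>"
      then obtain i j where ij: "(i, j) \<in> sminversions \<sigma>" "p = (w i, w j)" by auto
      then show "p \<in> (SIGMA v:{1..n}. later_starts \<sigma> v)"
        using range[OF ij(1)] later_starts_letter_iff letter_in by blast
    next
      fix p assume "p \<in> (SIGMA v:{1..n}. later_starts \<sigma> v)"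
      then obtain u v where p: "p = (u, v)" "u \<in> {1..n}" "v \<in> later_starts \<sigma> u" by blast
      then have "v \<in> {1..n}" using later_starts_subset by blast
      then obtain j where j: "j \<in> {1..n}" "v = w j" by (rule letter_surj)
      obtain i where i: "i \<in> {1..n}" "u = w i" using p(2) by (rule letter_surj)
      have "(i, j) \<in> sminversions \<sigma>"
        using p(3) later_starts_letter_iff[OF i(1) j(1)] unfolding i(2) j(2) by blast
      then show "p \<in> map_prod w w ` sminversions \<sigma>"
        unfolding p(1) i(2) j(2) by (rule map_prod_imageI)
    qed
  qed
  then have "sminv \<sigma> = card (SIGMA v:{1..n}. later_starts \<sigma> v)"
    unfolding sminv_def by (rule bij_betw_same_card)
  also have "\<dots> = (\<Sum>v=1..n. card (later_starts \<sigma> v))"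
    using later_starts_subset by (intro card_SigmaI) (auto intro: finite_subset)
  finally show ?thesis .
qed

text \<open>The positions of \<open>m\<close> and \<open>m + 1\<close> are unique and different, so
  the quantifiers over positions vanish and \<open>j < i\<close> becomes the negation of
  \<open>i < j\<close>.\<close>

lemma Split_iff:
  assumes "m \<in> {1..<n}"
  shows "m \<in> Split \<sigma> \<longleftrightarrow>
     m \<notin> thin_vals \<sigma> \<and> m + 1 \<in> thin_vals \<sigma>
     \<or> m \<in> thin_vals \<sigma> \<and> m + 1 \<in> thin_vals \<sigma> \<and> (m, m + 1) \<in> before (concat \<sigma>)
     \<or> m \<notin> thin_vals \<sigma> \<and> m + 1 \<notin> thin_vals \<sigma> \<and> (m, m + 1) \<notin> before (concat \<sigma>)"
proof -
  have m: "m \<in> {1..n}" "m + 1 \<in> {1..n}" using assms by auto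
  obtain i where i: "i \<in> {1..n}" "m = w i" using m(1) by (rule letter_surj)
  obtain j where j: "j \<in> {1..n}" "m + 1 = w j" using m(2) by (rule letter_surj)
  note ij = i(1) j(1) i(2)[symmetric] j(2)[symmetric]
  have uniq: "k = i" if "k \<in> {1..n}" "w k = m" for k
    using letter_inj[OF that(1) ij(1)] that(2) ij(3) by simp
  have uniq': "k = j" if "k \<in> {1..n}" "w k = m + 1" for k
    using letter_inj[OF that(1) ij(2)] that(2) ij(4) by simp
  have "m \<in> Split \<sigma> \<longleftrightarrow> thick \<sigma> i \<and> thin \<sigma> j \<or> thin \<sigma> i \<and> thin \<sigma> j \<and> i < j
      \<or> thick \<sigma> i \<and> thick \<sigma> j \<and> j < i" (is "_ \<longleftrightarrow> ?Q i j")
  proof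
    assume "m \<in> Split \<sigma>"
    then obtain i' j' where "i' \<in> {1..n}" "j' \<in> {1..n}" "w i' = m" "w j' = m + 1" "?Q i' j'"
      unfolding Split_def length_concat_segmented mem_Collect_eq by blast
    moreover from this(1,3) have "i' = i" by (rule uniq)
    moreover from calculation(2,4) have "j' = j" by (rule uniq')
    ultimately show "?Q i j" by (simp only:)
  next
    assume "?Q i j"
    with ij assms show "m \<in> Split \<sigma>"
      unfolding Split_def length_concat_segmented mem_Collect_eq by blast
  qed
  moreover have "(m, m + 1) \<in> before (concat \<sigma>) \<longleftrightarrow> i < j"
    using before_letter_iff[OF ij(1,2)] unfolding ij .
  moreover have "j < i \<longleftrightarrow> \<not> i < j" using ij by (cases i j rule: linorder_cases) auto
  ultimately show ?thesis
    unfolding thin_iff[OF ij(1)] thin_iff[OF ij(2)] thick_iff[OF ij(1)] thick_iff[OF ij(2)] ij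
    by (simp only:)
qed

text \<open>Thin values are those with \<theta>-exponent 1, so the clauses on both sides correspond
  one by one; \<open>before_Suc_iff\<close> turns the comparison of exponents into the order of
  \<open>m\<close> and \<open>m + 1\<close>.\<close>

lemma Asc_monomial_of: "Asc n (monomial_of \<sigma>) = Split \<sigma>"
proof -
  have "Split \<sigma> \<subseteq> {1..<n}" unfolding Split_def length_concat_segmented by blast
  moreover have "m \<in> Asc n (monomial_of \<sigma>) \<longleftrightarrow> m \<in> Split \<sigma>" if m: "m \<in> {1..<n}" for m
    unfolding Split_iff[OF m]
    using before_Suc_iff[OF \<sigma> m] m
    by (auto simp: Asc_def theta_exp_def xi_exp_def not_le)
  moreover have "Asc n (monomial_of \<sigma>) \<subseteq> {1..<n}" unfolding Asc_def by blast
  ultimately show ?thesis by blast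
qed

lemma thin_vals_subset: "thin_vals \<sigma> \<subseteq> {1..n}"
  and descent_tops_subset: "descent_tops \<sigma> \<subseteq> {1..n}"
  using adj_subset_segmented unfolding thin_vals_def descent_tops_def by blast+

lemma degrees_monomial_of:
  "deg_theta n (monomial_of \<sigma>) = card (sp_ascents \<sigma>)"
  "deg_xi n (monomial_of \<sigma>) = card (sp_descents \<sigma>)"
  "deg_x n (monomial_of \<sigma>) = sminv \<sigma>"
proof -
  have "(\<Sum>i=1..n. of_bool (i \<in> A)) = card A" if "A \<subseteq> {1..n}" for A
    using that by (simp add: Int_absorb1)
  then show "deg_theta n (monomial_of \<sigma>) = card (sp_ascents \<sigma>)"
    "deg_xi n (monomial_of \<sigma>) = card (sp_descents \<sigma>)"
    using thin_vals_subset descent_tops_subset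
    unfolding deg_theta_def deg_xi_def theta_exp_def xi_exp_def monomial_of_sel
      card_sp_ascents card_sp_descents by blast+
  show "deg_x n (monomial_of \<sigma>) = sminv \<sigma>"
    unfolding deg_x_def monomial_of_sel sminv_eq ..
qed

text \<open>Ascents and descents are disjoint sets among the \<open>n - 1\<close> gaps; this puts
  every segmented permutation into the index range of the double sum.\<close>

lemma ascents_descents_bound:
  assumes "n \<ge> 1"
  shows "card (sp_ascents \<sigma>) + card (sp_descents \<sigma>) < n"
proof -
  have "sp_ascents \<sigma> \<inter> sp_descents \<sigma> = {}" by (auto simp: sp_ascents_def sp_descents_def)
  moreover have sub: "sp_ascents \<sigma> \<subseteq> {1..<n}" "sp_descents \<sigma> \<subseteq> {1..<n}"
    by (auto simp: sp_ascents_def sp_descents_def length_concat_segmented)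
  moreover from sub have "finite (sp_ascents \<sigma>)" "finite (sp_descents \<sigma>)"
    using finite_subset by blast+
  ultimately have "card (sp_ascents \<sigma>) + card (sp_descents \<sigma>) = card (sp_ascents \<sigma> \<union> sp_descents \<sigma>)"
    by (simp add: card_Un_disjoint)
  also have "\<dots> \<le> card {1..<n}" using sub by (intro card_mono) auto
  finally show ?thesis using assms by simp
qed

end

section \<open>Regrouping the sum by the numbers of ascents and descents\<close>

lemma finite_segmented_permutations: "finite (segmented_permutations n)"
proof -
  let ?blocks = "{b :: nat list. set b \<subseteq> {1..n} \<and> length b \<le> n}"
  have "\<sigma> \<in> {\<sigma>. set \<sigma> \<subseteq> ?blocks \<and> length \<sigma> \<le> n}" if \<sigma>: "\<sigma> \<in> segmented_permutations n" for \<sigma>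
  proof -
    have len: "length (concat \<sigma>) = n" using length_concat_segmented[OF \<sigma>] .
    \<comment> \<open>Each nonempty block contributes a letter, which bounds the number of
      blocks.\<close>
    have "length \<sigma> \<le> length (concat \<sigma>)" if "[] \<notin> set \<sigma>" for \<sigma> :: segperm
      using that
    proof (induction \<sigma>)
      case (Cons b \<sigma>)
      then have "length b > 0" "length \<sigma> \<le> length (concat \<sigma>)" by auto
      then show ?case unfolding concat.simps length_append list.size by linarith
    qed simp
    then have "length \<sigma> \<le> n" using \<sigma> len unfolding segmented_permutations_iff by metis
    moreover have "b \<in> ?blocks" if "b \<in> set \<sigma>" for b
    proof -
      obtain A D where "\<sigma> = A @ b # D" using \<open>b \<in> set \<sigma>\<close> by (meson split_list)
      then show ?thesis using \<sigma> len unfolding segmented_permutations_iff by auto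
    qed
    ultimately show ?thesis by blast
  qed
  then have "segmented_permutations n \<subseteq> {\<sigma>. set \<sigma> \<subseteq> ?blocks \<and> length \<sigma> \<le> n}" by blast
  moreover have "finite {\<sigma>. set \<sigma> \<subseteq> ?blocks \<and> length \<sigma> \<le> n}"
    by (intro finite_lists_length_le) simp
  ultimately show ?thesis by (rule finite_subset)
qed

lemma scale_sum: "scale c (\<Sum>i\<in>I. f i) = (\<Sum>i\<in>I. scale c (f i))"
proof (induction I rule: infinite_finite_induct)
  case (insert i I)
  have "scale c (f i + g) = scale c (f i) + scale c g" for g
    by (rule ext) (simp add: scale_def distrib_left)
  then show ?case unfolding sum.insert[OF insert.hyps] insert.IH[symmetric] by blast
qed (simp_all add: scale_def zero_fun_def)

lemma scale_scale: "scale c (scale d f) = scale (c * d) f"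
  by (simp add: scale_def mult.assoc)

theorem theorem6p6:
  fixes n :: nat
  assumes "n \<ge> 1"
  shows
    "(\<Sum>b\<in>B12 n. scale (ind_u ^ deg_theta n b * ind_v ^ deg_xi n b * ind_q ^ deg_x n b)
                   (fundamental_qsym (Asc n b) n))
     = (\<Sum>(k, l)\<in>{(k, l). k + l < n}. scale (ind_u ^ k * ind_v ^ l)
          (\<Sum>\<sigma>\<in>SW n k l. scale (ind_q ^ sminv \<sigma>) (fundamental_qsym (Split \<sigma>) n)))"
proof -
  define G where "G b = scale (ind_u ^ deg_theta n b * ind_v ^ deg_xi n b * ind_q ^ deg_x n b)
    (fundamental_qsym (Asc n b) n)" for b
  define F where "F \<sigma> = scale (ind_u ^ card (sp_ascents \<sigma>) * ind_v ^ card (sp_descents \<sigma>) * ind_q ^ sminv \<sigma>)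
    (fundamental_qsym (Split \<sigma>) n)" for \<sigma>
  define K where "K = {(k, l). k + l < n}"
  define stat where "stat \<sigma> = (card (sp_ascents \<sigma>), card (sp_descents \<sigma>))" for \<sigma>
  have "K \<subseteq> {..<n} \<times> {..<n}" by (auto simp: K_def)
  then have finK: "finite K" by (rule finite_subset) simp
  have "(\<Sum>b\<in>B12 n. scale (ind_u ^ deg_theta n b * ind_v ^ deg_xi n b * ind_q ^ deg_x n b)
           (fundamental_qsym (Asc n b) n)) = (\<Sum>b\<in>B12 n. G b)"
    by (simp only: G_def)
  also have "\<dots> = (\<Sum>\<sigma>\<in>segmented_permutations n. G (monomial_of \<sigma>))"
    using conjunct1[OF monomial_of_bij[OF assms]] by (rule sum.reindex_bij_betw[symmetric])
  also have "\<dots> = (\<Sum>\<sigma>\<in>segmented_permutations n. F \<sigma>)"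
    unfolding F_def G_def
    by (intro sum.cong refl) (simp only: Asc_monomial_of degrees_monomial_of)
  \<comment> \<open>The sum is split along the fibres of \<open>stat\<close>, whose values lie in
    the finite set \<open>K\<close>.\<close>
  also have "\<dots> = (\<Sum>p\<in>K. \<Sum>\<sigma>\<in>{\<sigma> \<in> segmented_permutations n. stat \<sigma> = p}. F \<sigma>)"
  proof (intro sum.group[symmetric] finite_segmented_permutations finK image_subsetI)
    fix \<sigma> assume "\<sigma> \<in> segmented_permutations n"
    then show "stat \<sigma> \<in> K" unfolding K_def stat_def using ascents_descents_bound assms by blast
  qed
  also have "\<dots> = (\<Sum>(k, l)\<in>K. scale (ind_u ^ k * ind_v ^ l)
      (\<Sum>\<sigma>\<in>SW n k l. scale (ind_q ^ sminv \<sigma>) (fundamental_qsym (Split \<sigma>) n)))"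
  proof (intro sum.cong refl, clarify)
    fix k l
    have "{\<sigma> \<in> segmented_permutations n. stat \<sigma> = (k, l)} = SW n k l"
      unfolding SW_def stat_def by blast
    \<comment> \<open>On one fibre the powers of \<open>ind_u\<close> and \<open>ind_v\<close> are
      constant, so they can be pulled out of the inner sum.\<close>
    moreover have "F \<sigma> = scale (ind_u ^ k * ind_v ^ l)
        (scale (ind_q ^ sminv \<sigma>) (fundamental_qsym (Split \<sigma>) n))" if "\<sigma> \<in> SW n k l" for \<sigma>
      using that unfolding F_def scale_scale SW_def by blast
    ultimately show "sum F {\<sigma> \<in> segmented_permutations n. stat \<sigma> = (k, l)} =
        scale (ind_u ^ k * ind_v ^ l)
          (\<Sum>\<sigma>\<in>SW n k l. scale (ind_q ^ sminv \<sigma>) (fundamental_qsym (Split \<sigma>) n))"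
      unfolding scale_sum by (simp only: cong: sum.cong)
  qed
  finally show ?thesis unfolding K_def .
qed

end
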